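(* Let $p,q$ be complex numbers. The generating function of the products $L_{p,q,n}L_{p,q,2n+1}$ of $(p,q)$-Lucas numbers is, as a formal power series in $z$, $$\sum_{n=0}^{\infty}L_{p,q,n}L_{p,q,2n+1}z^n=\frac{2p-p^2(p^2+q)z+3pq^2(p^2+2q)z^2-p^2q^4z^3}{1-p(p^2+2q)z-q(p^4+3p^2q+2q^2)z^2+pq^3(p^2+2q)z^3+q^6z^4}.$$
   Context: The $(p,q)$-Lucas numbers are defined by $L_{p,q,0}=2$, $L_{p,q,1}=p$, and $L_{p,q,n}=pL_{p,q,n-1}+qL_{p,q,n-2}$ for $n\ge 2$. *)

theory Defs
  imports Complex_Main "HOL-Computational_Algebra.Formal_Power_Series"
begin

fun pq_lucas :: "complex \<Rightarrow> complex \<Rightarrow> nat \<Rightarrow> complex" where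
  "pq_lucas p q 0 = 2"
| "pq_lucas p q (Suc 0) = p"
| "pq_lucas p q (Suc (Suc n)) = p * pq_lucas p q (Suc n) + q * pq_lucas p q n"

end

theory Submission
  imports Defs
begin

text \<open>
  If \<open>a\<close> and \<open>b\<close> are the roots of \<open>t\<^sup>2 - p t - q\<close>, the products \<open>L\<^sub>n L\<^sub>2\<^sub>n\<^sub>+\<^sub>1\<close> are
  combinations of the \<open>n\<close>-th powers of \<open>a\<^sup>3\<close>, \<open>b\<^sup>3\<close>, \<open>a\<^sup>2 b\<close>, \<open>a b\<^sup>2\<close>. The denominator is
  the reciprocal polynomial of \<open>(t - a\<^sup>3)(t - b\<^sup>3)(t - a\<^sup>2 b)(t - a b\<^sup>2)\<close>, and so encodes a linear
  recurrence of order four satisfied by these products.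
\<close>

text \<open>Since \<open>a^2 + b^2 = p^2 + 2 * q\<close> and \<open>(a * b)^2 = q^2\<close>, passing
  to every second index squares the roots and gives these coefficients.\<close>

lemma pq_lucas_add_4:
  "pq_lucas p q (n + 4) = (p^2 + 2 * q) * pq_lucas p q (n + 2) - q^2 * pq_lucas p q n"
  by (simp add: eval_nat_numeral algebra_simps)

lemma pq_lucas_product_recurrence:
  fixes p q :: complex
  defines "c \<equiv> \<lambda>n. pq_lucas p q n * pq_lucas p q (2 * n + 1)"
  shows "c (n + 4) = p * (p^2 + 2 * q) * c (n + 3) + q * (p^4 + 3 * p^2 * q + 2 * q^2) * c (n + 2)
    - p * q^3 * (p^2 + 2 * q) * c (n + 1) - q^6 * c n"
proof -
  \<comment> \<open>Terms of index \<open>n + k\<close> are linear in \<open>x\<close>,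
    \<open>y\<close>; odd-indexed terms from \<open>2 * n + 1\<close> on are linear in
    \<open>u\<close>, \<open>w\<close>. The claim thus becomes a polynomial identity in
    \<open>p\<close>, \<open>q\<close>, \<open>x\<close>, \<open>y\<close>, \<open>u\<close>,
    \<open>w\<close>.\<close>
  define x y u w where "x = pq_lucas p q n" and "y = pq_lucas p q (n + 1)"
    and "u = pq_lucas p q (2 * n + 1)" and "w = pq_lucas p q (2 * n + 3)"
  have single: "pq_lucas p q (n + 2) = p * y + q * x"
    "pq_lucas p q (n + 3) = (p^2 + q) * y + p * q * x"
    "pq_lucas p q (n + 4) = (p^3 + 2 * p * q) * y + (p^2 * q + q^2) * x"
    by (simp_all add: x_def y_def eval_nat_numeral algebra_simps)
  let ?s = "p^2 + 2 * q"
  have five: "pq_lucas p q (2 * n + 5) = ?s * w - q^2 * u"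
    using pq_lucas_add_4[of p q "2 * n + 1"] by (simp add: u_def w_def eval_nat_numeral)
  have seven: "pq_lucas p q (2 * n + 7) = ?s * (?s * w - q^2 * u) - q^2 * w"
    using pq_lucas_add_4[of p q "2 * n + 3"] five
    by (simp add: w_def ac_simps del: pq_lucas.simps)
  have nine: "pq_lucas p q (2 * n + 9) =
      ?s * (?s * (?s * w - q^2 * u) - q^2 * w) - q^2 * (?s * w - q^2 * u)"
    using pq_lucas_add_4[of p q "2 * n + 5"] five seven
    by (simp add: ac_simps del: pq_lucas.simps)
  have products: "c (n + 4) = pq_lucas p q (n + 4) * pq_lucas p q (2 * n + 9)"
    "c (n + 3) = pq_lucas p q (n + 3) * pq_lucas p q (2 * n + 7)"
    "c (n + 2) = pq_lucas p q (n + 2) * pq_lucas p q (2 * n + 5)"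
    "c (n + 1) = y * w" "c n = x * u"
    by (simp_all add: c_def x_def y_def u_def w_def add.assoc del: pq_lucas.simps)
      (simp_all add: eval_nat_numeral)
  show ?thesis
    unfolding products single five seven nine by algebra
qed

theorem theorem13:
  fixes p q :: complex
  shows "Abs_fps (\<lambda>n. pq_lucas p q n * pq_lucas p q (2 * n + 1)) =
    (fps_const (2 * p) - fps_const (p^2 * (p^2 + q)) * fps_X
       + fps_const (3 * p * q^2 * (p^2 + 2 * q)) * fps_X^2
       - fps_const (p^2 * q^4) * fps_X^3) /
    (1 - fps_const (p * (p^2 + 2 * q)) * fps_X
       - fps_const (q * (p^4 + 3 * p^2 * q + 2 * q^2)) * fps_X^2
       + fps_const (p * q^3 * (p^2 + 2 * q)) * fps_X^3
       + fps_const (q^6) * fps_X^4)"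
    (is "?F = ?N / ?D")
proof -
  define c where "c = (\<lambda>n. pq_lucas p q n * pq_lucas p q (2 * n + 1))"
  have D0: "fps_nth ?D 0 = 1"
    by simp
  have initial: "c 0 = 2 * p" "c 1 = p^4 + 3 * p^2 * q"
    "c 2 = (p^2 + 2 * q) * (p^5 + 5 * p^3 * q + 5 * p * q^2)"
    "c 3 = (p^3 + 3 * p * q) * (p^7 + 7 * p^5 * q + 14 * p^3 * q^2 + 7 * p * q^3)"
    unfolding c_def by (simp_all add: eval_nat_numeral algebra_simps)
  have recurrence: "c (n + 4) = p * (p^2 + 2 * q) * c (n + 3)
      + q * (p^4 + 3 * p^2 * q + 2 * q^2) * c (n + 2)
      - p * q^3 * (p^2 + 2 * q) * c (n + 1) - q^6 * c n" for n
    unfolding c_def by (rule pq_lucas_product_recurrence)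
  have coeff: "fps_nth (Abs_fps c * ?D) n = c n
      - p * (p^2 + 2 * q) * (if n < 1 then 0 else c (n - 1))
      - q * (p^4 + 3 * p^2 * q + 2 * q^2) * (if n < 2 then 0 else c (n - 2))
      + p * q^3 * (p^2 + 2 * q) * (if n < 3 then 0 else c (n - 3))
      + q^6 * (if n < 4 then 0 else c (n - 4))" for n
  proof -
    \<comment> \<open>Writing \<open>fps_X^1\<close> lets one shift rule for powers of
      \<open>fps_X\<close> treat all four terms; it yields 0 where the shifted index would be
      negative.\<close>
    have "Abs_fps c * ?D = Abs_fps c
        - fps_const (p * (p^2 + 2 * q)) * (Abs_fps c * fps_X^1)
        - fps_const (q * (p^4 + 3 * p^2 * q + 2 * q^2)) * (Abs_fps c * fps_X^2)
        + fps_const (p * q^3 * (p^2 + 2 * q)) * (Abs_fps c * fps_X^3)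
        + fps_const (q^6) * (Abs_fps c * fps_X^4)"
      by (simp only: power_one_right) algebra
    then show ?thesis
      by (simp only: fps_add_nth fps_sub_nth fps_mult_left_const_nth fps_X_power_mult_right_nth
          fps_nth_Abs_fps)
  qed
  have product: "Abs_fps c * ?D = ?N"
  proof (rule fps_ext)
    fix n :: nat
    \<comment> \<open>The numerator has degree at most 3, so the initial values settle the first
      four coefficients and the recurrence makes all others vanish.\<close>
    have "n = 0 \<or> n = 1 \<or> n = 2 \<or> n = 3 \<or> n = (n - 4) + 4"
      by linarith
    then consider "n = 0" | "n = 1" | "n = 2" | "n = 3" | m where "n = m + 4"
      by blast
    then show "fps_nth (Abs_fps c * ?D) n = fps_nth ?N n"
    proof cases
      case 1
      show ?thesis unfolding coeff 1 by (simp add: initial)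
    next
      case 2
      show ?thesis unfolding coeff 2
        by (simp add: initial[unfolded One_nat_def]) algebra
    next
      case 3
      show ?thesis unfolding coeff 3
        by (simp add: initial[unfolded One_nat_def]) algebra
    next
      case 4
      show ?thesis unfolding coeff 4
        by (simp add: initial[unfolded One_nat_def]) algebra
    next
      case (5 m)
      have indices: "m + 4 - 1 = m + 3" "m + 4 - 2 = m + 2" "m + 4 - 3 = m + 1" "m + 4 - 4 = m"
        and "\<not> m + 4 < 1" "\<not> m + 4 < 2" "\<not> m + 4 < 3" "\<not> m + 4 < 4"
        by simp_all
      \<comment> \<open>This is the exact shape left once \<open>recurrence\<close> replaces
        \<open>c (m + 4)\<close>: its four terms meet their negatives from
        \<open>?D\<close>.\<close>
      moreover have "a + b - d - e - a - b + d + e = 0" for a b d e :: complex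
        by simp
      ultimately have "fps_nth (Abs_fps c * ?D) (m + 4) = 0"
        by (simp only: coeff recurrence indices if_False)
      moreover have "fps_nth ?N (m + 4) = 0"
        by simp
      ultimately show ?thesis
        by (simp only: 5)
    qed
  qed
  \<comment> \<open>The constant term 1 makes the denominator nonzero, so it can be cancelled in the
    division.\<close>
  have "?D \<noteq> 0"
    using D0 by (metis fps_zero_nth zero_neq_one)
  then have "Abs_fps c = Abs_fps c * ?D / ?D"
    by (rule nonzero_mult_div_cancel_right[symmetric])
  then show ?thesis
    unfolding product by (simp only: c_def)
qed

end
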